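(* Let $S$ be a semigroup and let $\sigma:S\to S$ be an automorphism (not necessarily involutive). The solutions $f,g:S\to\mathbb{C}$ of the functional equation $$g(x\sigma(y))=g(x)g(y)+f(x)f(y),\quad x,y\in S,$$ are exactly the following pairs: (1) $g=0$ and $f=0$. (2) $g$ is any non-zero function such that $g=0$ on $S^2$, and $f=cg$, where $c\in\{i,-i\}$. (3) $g=\dfrac{1}{1+\alpha^2}\chi$ and $f=\dfrac{\alpha}{1+\alpha^2}\chi$, where $\alpha\in\mathbb{C}\setminus\{i,-i\}$ is a constant and $\chi:S\to\mathbb{C}$ is a non-zero multiplicative function such that $\chi^*=\chi$. (4) $g=\dfrac{\delta^{-1}\chi_1+\delta\chi_2}{\delta^{-1}+\delta}$ and $f=\dfrac{\chi_2-\chi_1}{\delta^{-1}+\delta}$, where $\delta\in\mathbb{C}\setminus\{0,i,-i\}$ and $\chi_1,\chi_2:S\to\mathbb{C}$ are two different multiplicative functions such that $\chi_1^*=\chi_1$ and $\chi_2^*=\chi_2$. (5) $g=\dfrac{\chi+\chi^*}{2}$ and $f=\dfrac{\chi-\chi^*}{2i}$, where $\chi:S\to\mathbb{C}$ is a multiplicative function such that $\chi^*\neq\chi$ and $\chi\circ\sigma^2=\chi$. (6) $f=-i\phi_\chi$ and $g=\chi\pm\phi_\chi$, where $\chi:S\to\mathbb{C}$ is a non-zero multiplicative function and $\phi_\chi:S\to\mathbb{C}$ satisfies $\phi_\chi(xy)=\phi_\chi(x)\chi(y)+\phi_\chi(y)\chi(x)$ for all $x,y\in S$, such that $\chi^*=\chi$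 and $\phi_\chi^*=\phi_\chi$. Moreover, $f$ and $g$ are abelian in each case. Furthermore, if $S$ is a topological semigroup and $g\in C(S)$, then $f,\chi,\chi^*,\chi_1,\chi_2,\phi_\chi\in C(S)$ (for those of these functions that occur in the respective case).
   Context: A semigroup is a set with an associative binary operation. An automorphism $\sigma:S\to S$ is a bijection with $\sigma(xy)=\sigma(x)\sigma(y)$ for all $x,y\in S$. A function $\mu:S\to\mathbb{C}$ is multiplicative if $\mu(xy)=\mu(x)\mu(y)$ for all $x,y\in S$ (the zero function is allowed). For $f:S\to\mathbb{C}$, put $f^*:=f\circ\sigma$. $S^2:=\{xy\mid x,y\in S\}$. A function $f:S\to\mathbb{C}$ is central if $f(xy)=f(yx)$ for all $x,y\in S$, and abelian if it is central and $f(xyz)=f(xzy)$ for all $x,y,z\in S$. A topological semigroup is a semigroup with a topology such that the product $(x,y)\mapsto xy$ is continuous from $S\times S$ (product topology) to $S$; then $C(S)$ denotes the set of continuous functions $S\to\mathbb{C}$. (The automorphism $\sigma$ is not assumed continuous.) *)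

theory Defs
  imports "HOL-Analysis.Analysis"
begin

text \<open>
  The semigroup \<open>S\<close> is the type \<open>'a :: semigroup_mult\<close>; \<open>f\<^sup>*\<close> is written \<open>f \<circ> \<sigma>\<close>.
  The multiplicative functions are called \<open>chi\<close>, since the Greek letter is a vector binder in HOL-Analysis.
\<close>

definition semigroup_automorphism :: "('a::semigroup_mult \<Rightarrow> 'a) \<Rightarrow> bool" where
  "semigroup_automorphism \<sigma> \<longleftrightarrow> bij \<sigma> \<and> (\<forall>x y. \<sigma> (x * y) = \<sigma> x * \<sigma> y)"

definition multiplicative :: "('a::semigroup_mult \<Rightarrow> complex) \<Rightarrow> bool" where
  "multiplicative \<mu> \<longleftrightarrow> (\<forall>x y. \<mu> (x * y) = \<mu> x * \<mu> y)"

definition square_set :: "'a::semigroup_mult set" where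
  "square_set = {x * y |x y. True}"

definition central :: "('a::semigroup_mult \<Rightarrow> complex) \<Rightarrow> bool" where
  "central f \<longleftrightarrow> (\<forall>x y. f (x * y) = f (y * x))"

definition abelian :: "('a::semigroup_mult \<Rightarrow> complex) \<Rightarrow> bool" where
  "abelian f \<longleftrightarrow> central f \<and> (\<forall>x y z. f (x * y * z) = f (x * z * y))"

text \<open>
  Topologies are values of type \<open>'a topology\<close> rather than a type class instance, so that one
  and the same semigroup can be considered with and without a topology.
\<close>

definition topological_semigroup :: "'a::semigroup_mult topology \<Rightarrow> bool" where
  "topological_semigroup T \<longleftrightarrow>
     topspace T = UNIV \<and> continuous_map (prod_topology T T) T (\<lambda>(x, y). x * y)"

definition cfun :: "'a topology \<Rightarrow> ('a \<Rightarrow> complex) set" where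
  "cfun T = {h. continuous_map T euclidean h}"

definition solution ::
  "('a::semigroup_mult \<Rightarrow> 'a) \<Rightarrow> ('a \<Rightarrow> complex) \<Rightarrow> ('a \<Rightarrow> complex) \<Rightarrow> bool" where
  "solution \<sigma> f g \<longleftrightarrow> (\<forall>x y. g (x * \<sigma> y) = g x * g y + f x * f y)"

definition sine_addition ::
  "('a::semigroup_mult \<Rightarrow> complex) \<Rightarrow> ('a \<Rightarrow> complex) \<Rightarrow> bool" where
  "sine_addition chi \<phi> \<longleftrightarrow> (\<forall>x y. \<phi> (x * y) = \<phi> x * chi y + \<phi> y * chi x)"

definition family1 :: "('a::semigroup_mult \<Rightarrow> complex) \<Rightarrow> ('a \<Rightarrow> complex) \<Rightarrow> bool" where
  "family1 f g \<longleftrightarrow> g = (\<lambda>x. 0) \<and> f = (\<lambda>x. 0)"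

definition family2 ::
  "complex \<Rightarrow> ('a::semigroup_mult \<Rightarrow> complex) \<Rightarrow> ('a \<Rightarrow> complex) \<Rightarrow> bool" where
  "family2 c f g \<longleftrightarrow>
     g \<noteq> (\<lambda>x. 0) \<and> (\<forall>z\<in>square_set. g z = 0) \<and> c \<in> {\<i>, - \<i>} \<and> f = (\<lambda>x. c * g x)"

definition family3 ::
  "('a::semigroup_mult \<Rightarrow> 'a) \<Rightarrow> complex \<Rightarrow> ('a \<Rightarrow> complex) \<Rightarrow>
   ('a \<Rightarrow> complex) \<Rightarrow> ('a \<Rightarrow> complex) \<Rightarrow> bool" where
  "family3 \<sigma> \<alpha> chi f g \<longleftrightarrow>
     \<alpha> \<notin> {\<i>, - \<i>} \<and> multiplicative chi \<and> chi \<noteq> (\<lambda>x. 0) \<and> chi \<circ> \<sigma> = chi \<and>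
     g = (\<lambda>x. 1 / (1 + \<alpha>\<^sup>2) * chi x) \<and> f = (\<lambda>x. \<alpha> / (1 + \<alpha>\<^sup>2) * chi x)"

definition family4 ::
  "('a::semigroup_mult \<Rightarrow> 'a) \<Rightarrow> complex \<Rightarrow> ('a \<Rightarrow> complex) \<Rightarrow> ('a \<Rightarrow> complex) \<Rightarrow>
   ('a \<Rightarrow> complex) \<Rightarrow> ('a \<Rightarrow> complex) \<Rightarrow> bool" where
  "family4 \<sigma> \<delta> chi1 chi2 f g \<longleftrightarrow>
     \<delta> \<notin> {0, \<i>, - \<i>} \<and> multiplicative chi1 \<and> multiplicative chi2 \<and> chi1 \<noteq> chi2 \<and>
     chi1 \<circ> \<sigma> = chi1 \<and> chi2 \<circ> \<sigma> = chi2 \<and>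
     g = (\<lambda>x. (inverse \<delta> * chi1 x + \<delta> * chi2 x) / (inverse \<delta> + \<delta>)) \<and>
     f = (\<lambda>x. (chi2 x - chi1 x) / (inverse \<delta> + \<delta>))"

definition family5 ::
  "('a::semigroup_mult \<Rightarrow> 'a) \<Rightarrow> ('a \<Rightarrow> complex) \<Rightarrow>
   ('a \<Rightarrow> complex) \<Rightarrow> ('a \<Rightarrow> complex) \<Rightarrow> bool" where
  "family5 \<sigma> chi f g \<longleftrightarrow>
     multiplicative chi \<and> chi \<circ> \<sigma> \<noteq> chi \<and> chi \<circ> (\<sigma> ^^ 2) = chi \<and>
     g = (\<lambda>x. (chi x + (chi \<circ> \<sigma>) x) / 2) \<and> f = (\<lambda>x. (chi x - (chi \<circ> \<sigma>) x) / (2 * \<i>))"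

text \<open>The two signs are not interchangeable by \<open>\<phi> \<mapsto> - \<phi>\<close>, since this also changes \<open>f\<close>.\<close>

definition family6 ::
  "('a::semigroup_mult \<Rightarrow> 'a) \<Rightarrow> ('a \<Rightarrow> complex) \<Rightarrow> ('a \<Rightarrow> complex) \<Rightarrow>
   ('a \<Rightarrow> complex) \<Rightarrow> ('a \<Rightarrow> complex) \<Rightarrow> bool" where
  "family6 \<sigma> chi \<phi> f g \<longleftrightarrow>
     multiplicative chi \<and> chi \<noteq> (\<lambda>x. 0) \<and> sine_addition chi \<phi> \<and> chi \<circ> \<sigma> = chi \<and> \<phi> \<circ> \<sigma> = \<phi> \<and>
     f = (\<lambda>x. - \<i> * \<phi> x) \<and> (g = (\<lambda>x. chi x + \<phi> x) \<or> g = (\<lambda>x. chi x - \<phi> x))"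

end

theory Submission
  imports Defs
begin

text \<open>
  The idea is to turn the equation into the pure addition laws that it hides. Expanding
  \<open>g (x * \<sigma> (y * z))\<close> once as \<open>x\<close> times \<open>\<sigma> (y * z)\<close> and once as \<open>x * \<sigma> y\<close> times \<open>\<sigma> z\<close> gives a
  relation among \<open>g x\<close>, \<open>f x\<close> and \<open>f (x * \<sigma> y)\<close>.

  If \<open>f\<close> and \<open>g\<close> are linearly dependent and \<open>g\<close> is not zero, the equation is
  \<open>g (x * \<sigma> y) = k * g x * g y\<close> for a constant \<open>k\<close>, and associativity makes \<open>k * g\<close> multiplicative
  unless \<open>k = 0\<close>; this gives the second and third families (\<open>dependent_classification\<close>).

  If they are independent, comparing coefficients expresses \<open>g (y * z)\<close> and \<open>f (y * z)\<close>
  through products of values of \<open>g\<close> and \<open>f\<close>, and shows that \<open>\<sigma>\<close> fixes \<open>g\<close> and maps \<open>f\<close> to \<open>f\<close> or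
  to \<open>-f\<close> (\<open>independent_solution_cases\<close>). When \<open>f \<circ> \<sigma> = -f\<close>, these are the addition laws of
  cosine and sine, and \<open>g + \<i> * f\<close> is multiplicative. When \<open>f \<circ> \<sigma> = f\<close>, the function
  \<open>g + \<rho> * f\<close> is multiplicative for both roots \<open>\<rho>\<close> of a quadratic polynomial with constant
  term \<open>-1\<close>; distinct roots give two multiplicative functions, and a double root, necessarily
  \<open>\<i>\<close> or \<open>-\<i>\<close>, gives one multiplicative function together with a solution of the sine addition
  law.

  A function that vanishes on all products is abelian, and so are multiplicative functions,
  solutions of the sine addition law and their linear combinations; this covers every family.
  For the topology, \<open>f x * f y = g (x * \<sigma> y) - g x * g y\<close> with \<open>y\<close> held fixed shows that
  \<open>f\<close> is continuous with \<open>g\<close>, and in each family the remaining functions are linear combinations of \<open>f\<close> and \<open>g\<close>.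
\<close>

section \<open>Each family solves the equation\<close>

lemma solution_family1: "family1 f g \<Longrightarrow> solution \<sigma> f g"
  by (simp add: family1_def solution_def)

lemma solution_family2:
  assumes "family2 c f g"
  shows "solution \<sigma> f g"
proof -
  have "g (x * \<sigma> y) = 0" for x y
    using assms by (auto simp: family2_def square_set_def)
  then show ?thesis
    using assms by (auto simp: family2_def solution_def algebra_simps)
qed

lemma one_plus_square_nonzero:
  fixes c :: complex
  assumes "c \<notin> {\<i>, - \<i>}"
  shows "1 + c\<^sup>2 \<noteq> 0"
proof -
  have "(c + \<i>) * (c - \<i>) \<noteq> 0" using assms by (auto simp: add_eq_0_iff2)
  then show ?thesis by (simp add: algebra_simps power2_eq_square)
qed

lemma inverse_plus_self_nonzero:
  fixes \<delta> :: complex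
  assumes "\<delta> \<notin> {0, \<i>, - \<i>}"
  shows "inverse \<delta> + \<delta> \<noteq> 0"
  using one_plus_square_nonzero[of \<delta>] assms by (auto simp: field_simps power2_eq_square)

lemma solution_family3:
  assumes "family3 \<sigma> \<alpha> chi f g"
  shows "solution \<sigma> f g"
proof -
  have nz: "1 + \<alpha>\<^sup>2 \<noteq> 0"
    using assms one_plus_square_nonzero by (simp add: family3_def)
  have chi: "chi (x * \<sigma> y) = chi x * chi y" for x y
    using assms by (auto simp: family3_def multiplicative_def fun_eq_iff)
  have "1 / (1 + \<alpha>\<^sup>2) * (a * b) =
      1 / (1 + \<alpha>\<^sup>2) * a * (1 / (1 + \<alpha>\<^sup>2) * b) + \<alpha> / (1 + \<alpha>\<^sup>2) * a * (\<alpha> / (1 + \<alpha>\<^sup>2) * b)" for a b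
  proof -
    have "1 / (1 + \<alpha>\<^sup>2) * a * (1 / (1 + \<alpha>\<^sup>2) * b) + \<alpha> / (1 + \<alpha>\<^sup>2) * a * (\<alpha> / (1 + \<alpha>\<^sup>2) * b)
        = (1 + \<alpha>\<^sup>2) * (a * b) / ((1 + \<alpha>\<^sup>2) * (1 + \<alpha>\<^sup>2))"
      by (simp add: add_divide_distrib algebra_simps power2_eq_square)
    then show ?thesis using nz by simp
  qed
  moreover have "g = (\<lambda>x. 1 / (1 + \<alpha>\<^sup>2) * chi x)" "f = (\<lambda>x. \<alpha> / (1 + \<alpha>\<^sup>2) * chi x)"
    using assms by (simp_all add: family3_def)
  ultimately show ?thesis
    unfolding solution_def by (simp only: chi) blast
qed

lemma solution_family4:
  assumes "family4 \<sigma> \<delta> chi1 chi2 f g"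
  shows "solution \<sigma> f g"
proof -
  define s where "s = inverse \<delta> + \<delta>"
  have d: "\<delta> \<notin> {0, \<i>, - \<i>}" using assms by (simp add: family4_def)
  then have s: "s \<noteq> 0" unfolding s_def by (rule inverse_plus_self_nonzero)
  have chi: "chi1 (x * \<sigma> y) = chi1 x * chi1 y" "chi2 (x * \<sigma> y) = chi2 x * chi2 y" for x y
    using assms by (auto simp: family4_def multiplicative_def fun_eq_iff)
  have "(inverse \<delta> * (a * b) + \<delta> * (c * e)) / s =
      (inverse \<delta> * a + \<delta> * c) / s * ((inverse \<delta> * b + \<delta> * e) / s) + (c - a) / s * ((e - b) / s)"
    (is "?L / s = ?P / s * (?Q / s) + ?R / s * (?T / s)") for a b c e
  proof -
    have "?P / s * (?Q / s) + ?R / s * (?T / s) = (?P * ?Q + ?R * ?T) / (s * s)"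
      by (simp only: times_divide_times_eq flip: add_divide_distrib)
    also have "?P * ?Q + ?R * ?T = s * ?L"
      using d by (simp add: s_def field_simps)
    finally show ?thesis using s by simp
  qed
  moreover have "g = (\<lambda>x. (inverse \<delta> * chi1 x + \<delta> * chi2 x) / s)" "f = (\<lambda>x. (chi2 x - chi1 x) / s)"
    using assms by (simp_all add: family4_def s_def)
  ultimately show ?thesis
    unfolding solution_def by (simp only: chi) blast
qed

lemma solution_family5:
  assumes "semigroup_automorphism \<sigma>" "family5 \<sigma> chi f g"
  shows "solution \<sigma> f g"
proof -
  have "chi (\<sigma> (\<sigma> x)) = chi x" for x
    using assms(2) by (auto simp: family5_def fun_eq_iff numeral_2_eq_2)
  then show ?thesis
    using assms
    by (simp add: family5_def solution_def multiplicative_def semigroup_automorphism_def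
        field_simps power2_eq_square)
qed

lemma solution_family6:
  assumes "family6 \<sigma> chi \<phi> f g"
  shows "solution \<sigma> f g"
proof -
  have "chi (x * \<sigma> y) = chi x * chi y" "\<phi> (x * \<sigma> y) = \<phi> x * chi y + \<phi> y * chi x" for x y
    using assms by (auto simp: family6_def multiplicative_def sine_addition_def fun_eq_iff)
  then show ?thesis
    using assms by (auto simp: family6_def solution_def algebra_simps)
qed

section \<open>Linearly dependent solutions\<close>

text \<open>
  Here \<open>g (x * \<sigma> y) = (1 + c\<^sup>2) * g x * g y\<close>. Since \<open>\<sigma>\<close> is onto, \<open>c\<^sup>2 = -1\<close> means that \<open>g\<close> vanishes
  on all products.
\<close>

lemma dependent_classification:
  assumes aut: "semigroup_automorphism \<sigma>" and sol: "solution \<sigma> f g"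
    and f: "f = (\<lambda>x. c * g x)" and g: "g \<noteq> (\<lambda>x. 0)"
  shows "family2 c f g \<or> (\<exists>chi. family3 \<sigma> c chi f g)"
proof (cases "c \<in> {\<i>, - \<i>}")
  case True
  then have "g (x * \<sigma> y) = 0" for x y
    using sol f by (auto simp: solution_def algebra_simps)
  then have "g (x * y) = 0" for x y
    using aut by (metis semigroup_automorphism_def bij_pointE)
  then show ?thesis
    using True f g by (auto simp: family2_def square_set_def)
next
  case False
  define chi where "chi = (\<lambda>x. (1 + c\<^sup>2) * g x)"
  have nz: "1 + c\<^sup>2 \<noteq> 0" using False by (rule one_plus_square_nonzero)
  have chi: "chi (x * \<sigma> y) = chi x * chi y" for x y
    using sol by (simp add: solution_def chi_def f algebra_simps power2_eq_square)
  obtain w where w: "chi w \<noteq> 0"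
    using g nz by (auto simp: chi_def)
  \<comment> \<open>Both sides of the next identity are the value at \<open>w * \<sigma> y * \<sigma> z = w * \<sigma> (y * z)\<close>.\<close>
  have "chi w * chi (y * z) = chi w * (chi y * chi z)" for y z
    using aut chi[of w "y * z"] chi[of "w * \<sigma> y" z] chi[of w y]
    by (simp add: semigroup_automorphism_def mult.assoc)
  then have mult: "multiplicative chi"
    using w by (simp add: multiplicative_def)
  then have "chi w * chi (\<sigma> y) = chi w * chi y" for y
    using chi[of w y] by (simp add: multiplicative_def)
  then have "chi \<circ> \<sigma> = chi"
    using w by (simp add: fun_eq_iff)
  moreover have "chi \<noteq> (\<lambda>x. 0)"
    using w by metis
  moreover have "g = (\<lambda>x. 1 / (1 + c\<^sup>2) * chi x)" "f = (\<lambda>x. c / (1 + c\<^sup>2) * chi x)"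
    using nz by (simp_all add: chi_def f)
  ultimately have "family3 \<sigma> c chi f g"
    using mult False by (simp add: family3_def)
  then show ?thesis by blast
qed

section \<open>Linearly independent solutions\<close>

definition independent_pair :: "('a \<Rightarrow> complex) \<Rightarrow> ('a \<Rightarrow> complex) \<Rightarrow> bool" where
  "independent_pair f g \<longleftrightarrow> (\<forall>a b. (\<forall>x. a * g x + b * f x = 0) \<longrightarrow> a = 0 \<and> b = 0)"

lemma independent_pair_coeffs:
  assumes "independent_pair f g" "\<And>x. a * g x + b * f x = a' * g x + b' * f x"
  shows "a = a'" "b = b'"
proof -
  have "\<forall>x. (a - a') * g x + (b - b') * f x = 0"
    using assms(2) by (simp add: algebra_simps)
  then have "a - a' = 0 \<and> b - b' = 0"
    using assms(1) unfolding independent_pair_def by blast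
  then show "a = a'" "b = b'" by simp_all
qed

lemma dependent_pairE:
  assumes "\<not> independent_pair f g"
  obtains "g = (\<lambda>x. 0)" | c where "f = (\<lambda>x. c * g x)"
proof -
  obtain a b where ab: "\<And>x. a * g x + b * f x = 0" "a \<noteq> 0 \<or> b \<noteq> 0"
    using assms by (auto simp: independent_pair_def)
  show thesis
  proof (cases "b = 0")
    case True
    then show thesis using ab that(1) by auto
  next
    case False
    have "f x = (- a / b) * g x" for x
      using ab(1)[of x] False by (simp add: field_simps add_eq_0_iff)
    then show thesis using that(2) by blast
  qed
qed

lemma independent_pair_nonzero:
  assumes "independent_pair f g"
  obtains z where "f z \<noteq> 0"
proof -
  have "\<exists>z. f z \<noteq> 0"
  proof (rule ccontr)
    assume "\<nexists>z. f z \<noteq> 0"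
    then show False
      using independent_pair_coeffs(2)[OF assms, of 0 1 0 0] by simp
  qed
  then show thesis using that by blast
qed

text \<open>
  The two expansions of \<open>g (x * \<sigma> (y * z))\<close> read
  \<open>f (x * \<sigma> y) * f z = g x * (g (y * z) - g y * g z) + f x * (f (y * z) - f y * g z)\<close>.
  Fixing \<open>z\<close> with \<open>f z \<noteq> 0\<close> shows that \<open>f (x * \<sigma> y)\<close> is a combination of \<open>g x\<close> and \<open>f x\<close>; inserting
  this and comparing coefficients yields the last two identities.
\<close>

lemma independent_solution_products:
  assumes aut: "semigroup_automorphism \<sigma>" and sol: "solution \<sigma> f g"
    and ind: "independent_pair f g"
  obtains A B where "\<And>x y. f (x * \<sigma> y) = g x * A y + f x * B y"
    and "\<And>x y. g (x * y) = g x * g y + A x * f y"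
    and "\<And>x y. f (x * y) = f x * g y + B x * f y"
proof -
  obtain z0 where z0: "f z0 \<noteq> 0" using independent_pair_nonzero[OF ind] .
  define A where "A y = (g (y * z0) - g y * g z0) / f z0" for y
  define B where "B y = (f (y * z0) - f y * g z0) / f z0" for y
  have eq: "g (x * \<sigma> y) = g x * g y + f x * f y" for x y
    using sol by (simp add: solution_def)
  have key: "f (x * \<sigma> y) * f z = g x * (g (y * z) - g y * g z) + f x * (f (y * z) - f y * g z)"
    for x y z
    using aut eq[of x "y * z"] eq[of "x * \<sigma> y" z] eq[of x y]
    by (simp add: semigroup_automorphism_def mult.assoc algebra_simps)
  have f: "f (x * \<sigma> y) = g x * A y + f x * B y" for x y
  proof -
    have "f (x * \<sigma> y) = f (x * \<sigma> y) * f z0 / f z0" using z0 by simp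
    also have "\<dots> = g x * A y + f x * B y"
      unfolding key by (simp add: A_def B_def add_divide_distrib)
    finally show ?thesis .
  qed
  have "(A y * f z) * g x + (B y * f z) * f x
      = (g (y * z) - g y * g z) * g x + (f (y * z) - f y * g z) * f x" for x y z
    using key[of x y z] unfolding f by (simp add: algebra_simps)
  note coeffs = independent_pair_coeffs[OF ind this]
  show thesis
  proof
    show "g (x * y) = g x * g y + A x * f y" for x y
      using coeffs(1)[of x y] by simp
    show "f (x * y) = f x * g y + B x * f y" for x y
      using coeffs(2)[of x y] by simp
  qed (rule f)
qed

text \<open>
  Evaluating \<open>g (x * \<sigma> y)\<close> and \<open>f (x * \<sigma> y)\<close> by the product formulas as well as directly puts the
  unknown coefficients into the span of \<open>g\<close> and \<open>f\<close>, and then determines them up to the sign with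
  which \<open>\<sigma>\<close> acts on \<open>f\<close> and, for the sign \<open>+\<close>, one free constant \<open>\<delta>\<close>.
\<close>

lemma independent_solution_cases:
  assumes aut: "semigroup_automorphism \<sigma>" and sol: "solution \<sigma> f g"
    and ind: "independent_pair f g"
  obtains (even) \<delta> where "\<And>x. g (\<sigma> x) = g x" "\<And>x. f (\<sigma> x) = f x"
      "\<And>x y. g (x * y) = g x * g y + f x * f y"
      "\<And>x y. f (x * y) = f x * g y + g x * f y + \<delta> * f x * f y"
  | (odd) "\<And>x. g (\<sigma> x) = g x" "\<And>x. f (\<sigma> x) = - f x"
      "\<And>x y. g (x * y) = g x * g y - f x * f y"
      "\<And>x y. f (x * y) = f x * g y + g x * f y"
proof -
  obtain A B where f\<sigma>: "\<And>x y. f (x * \<sigma> y) = g x * A y + f x * B y"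
    and g: "\<And>x y. g (x * y) = g x * g y + A x * f y"
    and f: "\<And>x y. f (x * y) = f x * g y + B x * f y"
    using independent_solution_products[OF aut sol ind] by blast
  have g\<sigma>: "g (x * \<sigma> y) = g x * g y + f x * f y" for x y
    using sol by (simp add: solution_def)
  have eqg: "g x * g (\<sigma> y) + A x * f (\<sigma> y) = g x * g y + f x * f y" for x y
    using g\<sigma>[of x y] g[of x "\<sigma> y"] by simp
  have eqf: "f x * g (\<sigma> y) + B x * f (\<sigma> y) = g x * A y + f x * B y" for x y
    using f\<sigma>[of x y] f[of x "\<sigma> y"] by simp
  obtain z where "f z \<noteq> 0" using independent_pair_nonzero[OF ind] .
  moreover obtain w where "z = \<sigma> w"
    using aut by (metis semigroup_automorphism_def bij_pointE)
  ultimately have w: "f (\<sigma> w) \<noteq> 0" by simp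
  define \<alpha> \<beta> \<gamma> \<delta> where "\<alpha> = (g w - g (\<sigma> w)) / f (\<sigma> w)" and "\<beta> = f w / f (\<sigma> w)"
    and "\<gamma> = A w / f (\<sigma> w)" and "\<delta> = (B w - g (\<sigma> w)) / f (\<sigma> w)"
  have A: "A x = \<alpha> * g x + \<beta> * f x" for x
    using eqg[of x w] w by (simp add: \<alpha>_def \<beta>_def field_simps)
  have B: "B x = \<gamma> * g x + \<delta> * f x" for x
    using eqf[of x w] w by (simp add: \<gamma>_def \<delta>_def field_simps)
  have "(g (\<sigma> y) + \<alpha> * f (\<sigma> y)) * g x + (\<beta> * f (\<sigma> y)) * f x = g y * g x + f y * f x" for x y
    using eqg[of x y] by (simp add: A algebra_simps)
  note cg = independent_pair_coeffs[OF ind this]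
  have "(\<gamma> * f (\<sigma> y)) * g x + (g (\<sigma> y) + \<delta> * f (\<sigma> y)) * f x = A y * g x + B y * f x" for x y
    using eqf[of x y] by (simp add: B algebra_simps)
  note cf = independent_pair_coeffs[OF ind this]
  have \<beta>0: "\<beta> \<noteq> 0"
    using cg(2) independent_pair_nonzero[OF ind] by (metis mult_zero_left)
  have "\<alpha> * g y + \<beta> * f y = 0 * g y + (\<gamma> / \<beta>) * f y" for y
  proof -
    have "f (\<sigma> y) = f y / \<beta>" using cg(2)[of y] \<beta>0 by (simp add: field_simps)
    then show ?thesis using cf(1)[of y] by (simp add: A)
  qed
  note c1 = independent_pair_coeffs[OF ind this]
  then have \<alpha>: "\<alpha> = 0" and \<gamma>: "\<gamma> = \<beta>\<^sup>2"
    using \<beta>0 by (simp_all add: field_simps power2_eq_square)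
  have gs: "g (\<sigma> y) = g y" for y
    using cg(1)[of y] by (simp add: \<alpha>)
  have fs: "f (\<sigma> y) = (1 / \<beta>) * f y" for y
    using cg(2)[of y] \<beta>0 by (simp add: field_simps)
  have "1 * g y + (\<delta> / \<beta>) * f y = \<gamma> * g y + \<delta> * f y" for y
    using cf(2)[of y] unfolding B gs fs by simp
  note c2 = independent_pair_coeffs[OF ind this]
  have "\<beta>\<^sup>2 = 1" using c2(1) \<gamma> by simp
  then consider "\<beta> = 1" | "\<beta> = -1" by (auto simp: power2_eq_1_iff)
  then show thesis
  proof cases
    case 1
    show thesis
      by (rule even[of \<delta>]) (simp_all add: gs fs g f A B \<alpha> \<gamma> 1 algebra_simps)
  next
    case 2
    then have "\<delta> = 0" using c2(2) by simp
    then show thesis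
      by (intro odd) (simp_all add: gs fs g f A B \<alpha> \<gamma> 2 algebra_simps)
  qed
qed

lemma multiplicative_cos_plus_i_sin:
  assumes "\<And>x y. g (x * y) = g x * g y - f x * f y" "\<And>x y. f (x * y) = f x * g y + g x * f y"
  shows "multiplicative (\<lambda>x. g x + \<i> * f x)"
  using assms by (simp add: multiplicative_def algebra_simps)

text \<open>
  The products of \<open>f x\<close> and \<open>f y\<close> enter with coefficient \<open>1 + \<rho> * \<delta>\<close> on the left and \<open>\<rho>\<^sup>2\<close> on the
  right.
\<close>

lemma multiplicative_combination:
  assumes g: "\<And>x y. g (x * y) = g x * g y + f x * f y"
    and f: "\<And>x y. f (x * y) = f x * g y + g x * f y + \<delta> * f x * f y"
    and root: "\<rho>\<^sup>2 = \<delta> * \<rho> + 1"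
  shows "multiplicative (\<lambda>x. g x + \<rho> * f x)"
proof -
  have "g (x * y) + \<rho> * f (x * y) = (g x + \<rho> * f x) * (g y + \<rho> * f y)" for x y
  proof -
    have "(g x + \<rho> * f x) * (g y + \<rho> * f y)
        = g x * g y + \<rho> * (f x * g y + g x * f y) + \<rho>\<^sup>2 * (f x * f y)"
      by (simp add: algebra_simps power2_eq_square)
    also have "\<dots> = g (x * y) + \<rho> * f (x * y)"
      unfolding root g f by (simp add: algebra_simps)
    finally show ?thesis by simp
  qed
  then show ?thesis by (simp add: multiplicative_def)
qed

lemma independent_classification:
  assumes aut: "semigroup_automorphism \<sigma>" and sol: "solution \<sigma> f g"
    and ind: "independent_pair f g"
  shows "(\<exists>\<delta> chi1 chi2. family4 \<sigma> \<delta> chi1 chi2 f g) \<or> (\<exists>chi. family5 \<sigma> chi f g) \<or>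
    (\<exists>chi \<phi>. family6 \<sigma> chi \<phi> f g)"
  using aut sol ind
proof (cases rule: independent_solution_cases)
  case odd
  define chi where "chi = (\<lambda>x. g x + \<i> * f x)"
  have chis: "chi \<circ> \<sigma> = (\<lambda>x. g x - \<i> * f x)"
    by (simp add: chi_def odd fun_eq_iff)
  obtain z where "f z \<noteq> 0" using independent_pair_nonzero[OF ind] .
  then have "chi z \<noteq> g z - \<i> * f z"
    by (simp add: chi_def)
  then have "chi \<circ> \<sigma> \<noteq> chi"
    unfolding chis by metis
  moreover have "chi \<circ> (\<sigma> ^^ 2) = chi"
    by (simp add: chi_def odd fun_eq_iff numeral_2_eq_2)
  moreover have "multiplicative chi"
    unfolding chi_def using odd(3,4) by (rule multiplicative_cos_plus_i_sin)
  moreover have "g = (\<lambda>x. (chi x + (chi \<circ> \<sigma>) x) / 2)" "f = (\<lambda>x. (chi x - (chi \<circ> \<sigma>) x) / (2 * \<i>))"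
    unfolding chis by (simp_all add: chi_def)
  ultimately have "family5 \<sigma> chi f g"
    unfolding family5_def by blast
  then show ?thesis by blast
next
  case (even k)
  define l where "l = (k + csqrt (k\<^sup>2 + 4)) / 2"
  have root: "l\<^sup>2 = k * l + 1"
  proof -
    have "2 * l = k + csqrt (k\<^sup>2 + 4)" by (simp add: l_def field_simps)
    then have "(2 * l - k)\<^sup>2 = k\<^sup>2 + 4" by simp
    then have "4 * l\<^sup>2 = 4 * (k * l + 1)"
      by (simp add: algebra_simps power2_eq_square)
    then show ?thesis by (subst (asm) mult_left_cancel) simp_all
  qed
  then have l0: "l \<noteq> 0" by auto
  have k: "k = l - inverse l"
    using root l0 by (simp add: field_simps power2_eq_square)
  have inv: "(\<lambda>x. g x + t * f x) \<circ> \<sigma> = (\<lambda>x. g x + t * f x)" for t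
    by (simp add: fun_eq_iff even(1,2))
  show ?thesis
  proof (cases "l \<in> {\<i>, - \<i>}")
    case True
    define chi \<phi> where "chi = (\<lambda>x. g x + l * f x)" and "\<phi> = (\<lambda>x. \<i> * f x)"
    have "multiplicative chi"
      unfolding chi_def using even(3,4) root by (rule multiplicative_combination)
    moreover have "chi \<noteq> (\<lambda>x. 0)"
      using independent_pair_coeffs(1)[OF ind, of 1 l 0 0] by (auto simp: chi_def fun_eq_iff)
    moreover have "sine_addition chi \<phi>"
      using True by (auto simp: sine_addition_def chi_def \<phi>_def even k algebra_simps)
    moreover have "chi \<circ> \<sigma> = chi" unfolding chi_def by (rule inv)
    moreover have "\<phi> \<circ> \<sigma> = \<phi>" by (simp add: fun_eq_iff \<phi>_def even(2))
    moreover have "f = (\<lambda>x. - \<i> * \<phi> x)" by (simp add: \<phi>_def)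
    moreover have "g = (\<lambda>x. chi x + \<phi> x) \<or> g = (\<lambda>x. chi x - \<phi> x)"
      using True by (auto simp: chi_def \<phi>_def)
    ultimately have "family6 \<sigma> chi \<phi> f g"
      unfolding family6_def by blast
    then show ?thesis by blast
  next
    case False
    \<comment> \<open>The other root is \<open>- inverse l\<close>; since \<open>f\<close> is the difference of the two
      combinations divided by the difference of the roots, \<open>\<delta> = inverse l\<close> is the right parameter.\<close>
    define d where "d = inverse l"
    define chi1 chi2 where "chi1 = (\<lambda>x. g x + (- d) * f x)" and "chi2 = (\<lambda>x. g x + l * f x)"
    have ld: "l = inverse d" and d0: "d \<noteq> 0" using l0 by (simp_all add: d_def)
    have d: "d \<notin> {0, \<i>, - \<i>}" using d0 False unfolding ld by auto
    then have s: "inverse d + d \<noteq> 0" by (rule inverse_plus_self_nonzero)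
    have rootd: "(- d)\<^sup>2 = k * (- d) + 1"
      unfolding k ld using d0 by (simp add: field_simps power2_eq_square)
    have f: "f = (\<lambda>x. (chi2 x - chi1 x) / (inverse d + d))"
    proof
      fix x
      have "chi2 x - chi1 x = f x * (inverse d + d)"
        by (simp add: chi1_def chi2_def ld algebra_simps)
      then show "f x = (chi2 x - chi1 x) / (inverse d + d)" using s by simp
    qed
    have g: "g = (\<lambda>x. (inverse d * chi1 x + d * chi2 x) / (inverse d + d))"
    proof
      fix x
      have "inverse d * chi1 x + d * chi2 x = g x * (inverse d + d)"
        using d0 by (simp add: chi1_def chi2_def ld algebra_simps)
      then show "g x = (inverse d * chi1 x + d * chi2 x) / (inverse d + d)" using s by simp
    qed
    have "chi1 \<noteq> chi2"
      using f independent_pair_nonzero[OF ind] by (metis diff_self div_0)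
    moreover have "multiplicative chi1"
      unfolding chi1_def using even(3,4) rootd by (rule multiplicative_combination)
    moreover have "multiplicative chi2"
      unfolding chi2_def using even(3,4) root by (rule multiplicative_combination)
    moreover have "chi1 \<circ> \<sigma> = chi1" "chi2 \<circ> \<sigma> = chi2"
      unfolding chi1_def chi2_def by (rule inv)+
    ultimately have "family4 \<sigma> d chi1 chi2 f g"
      unfolding family4_def using d f g by blast
    then show ?thesis by blast
  qed
qed

section \<open>The classification\<close>

lemma solution_iff_families:
  assumes aut: "semigroup_automorphism \<sigma>"
  shows "solution \<sigma> f g \<longleftrightarrow>
    family1 f g \<or>
    (\<exists>c. family2 c f g) \<or>
    (\<exists>\<alpha> chi. family3 \<sigma> \<alpha> chi f g) \<or>
    (\<exists>\<delta> chi1 chi2. family4 \<sigma> \<delta> chi1 chi2 f g) \<or>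
    (\<exists>chi. family5 \<sigma> chi f g) \<or>
    (\<exists>chi \<phi>. family6 \<sigma> chi \<phi> f g)" (is "_ \<longleftrightarrow> ?R")
proof
  assume sol: "solution \<sigma> f g"
  have zero: "family1 f g" if "g = (\<lambda>x. 0)"
  proof -
    have "f x * f x = 0" for x
      using sol unfolding solution_def that by (metis add_0 mult_zero_left)
    then show ?thesis using that by (simp add: family1_def fun_eq_iff)
  qed
  show ?R
  proof (cases "independent_pair f g")
    case True
    then show ?thesis using independent_classification[OF aut sol] by blast
  next
    case False
    then show ?thesis
    proof (cases rule: dependent_pairE)
      case 1
      then show ?thesis using zero by blast
    next
      case (2 c)
      then show ?thesis using zero dependent_classification[OF aut sol] by blast
    qed
  qed
next
  assume ?R
  then show "solution \<sigma> f g"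
    by (elim disjE exE)
      (erule solution_family1 solution_family2 solution_family3 solution_family4
        solution_family5[OF aut] solution_family6)+
qed

section \<open>Commutativity\<close>

lemma abelian_multiplicative: "multiplicative chi \<Longrightarrow> abelian chi"
  by (simp add: multiplicative_def abelian_def central_def)

lemma abelian_sine_addition: "multiplicative chi \<Longrightarrow> sine_addition chi \<phi> \<Longrightarrow> abelian \<phi>"
  by (simp add: multiplicative_def sine_addition_def abelian_def central_def algebra_simps)

lemma abelian_linear_combination:
  assumes "abelian u" "abelian v" "\<And>x. h x = a * u x + b * v x"
  shows "abelian h"
  using assms(1,2) unfolding abelian_def central_def assms(3) by metis

lemma multiplicative_comp_automorphism:
  "semigroup_automorphism \<sigma> \<Longrightarrow> multiplicative chi \<Longrightarrow> multiplicative (chi \<circ> \<sigma>)"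
  by (simp add: multiplicative_def semigroup_automorphism_def)

lemma solution_abelian:
  assumes aut: "semigroup_automorphism \<sigma>" and sol: "solution \<sigma> f g"
  shows "abelian f \<and> abelian g"
proof -
  consider "family1 f g" | c where "family2 c f g" | \<alpha> chi where "family3 \<sigma> \<alpha> chi f g"
    | \<delta> chi1 chi2 where "family4 \<sigma> \<delta> chi1 chi2 f g" | chi where "family5 \<sigma> chi f g"
    | chi \<phi> where "family6 \<sigma> chi \<phi> f g"
    using sol unfolding solution_iff_families[OF aut] by blast
  then show ?thesis
  proof cases
    case 1
    then show ?thesis by (simp add: family1_def abelian_def central_def)
  next
    case 2
    then have "g (x * y) = 0" for x y by (auto simp: family2_def square_set_def)
    with 2 show ?thesis by (simp add: family2_def abelian_def central_def)
  next
    case 3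
    then have "abelian chi" by (simp add: family3_def abelian_multiplicative)
    moreover have "f x = \<alpha> / (1 + \<alpha>\<^sup>2) * chi x + 0 * chi x"
      "g x = 1 / (1 + \<alpha>\<^sup>2) * chi x + 0 * chi x" for x
      using 3 by (simp_all add: family3_def)
    ultimately show ?thesis using abelian_linear_combination by blast
  next
    case 4
    then have "abelian chi1" "abelian chi2" by (simp_all add: family4_def abelian_multiplicative)
    moreover have "f x = - (1 / (inverse \<delta> + \<delta>)) * chi1 x + 1 / (inverse \<delta> + \<delta>) * chi2 x"
      "g x = inverse \<delta> / (inverse \<delta> + \<delta>) * chi1 x + \<delta> / (inverse \<delta> + \<delta>) * chi2 x" for x
      using 4 by (simp_all add: family4_def add_divide_distrib diff_divide_distrib)
    ultimately show ?thesis using abelian_linear_combination by blast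
  next
    case 5
    then have "abelian chi" "abelian (chi \<circ> \<sigma>)"
      by (simp_all add: family5_def abelian_multiplicative multiplicative_comp_automorphism[OF aut])
    moreover have "f x = 1 / (2 * \<i>) * chi x + - (1 / (2 * \<i>)) * (chi \<circ> \<sigma>) x"
      "g x = 1 / 2 * chi x + 1 / 2 * (chi \<circ> \<sigma>) x" for x
      using 5 by (simp_all add: family5_def field_simps)
    ultimately show ?thesis using abelian_linear_combination by blast
  next
    case 6
    then have "abelian chi" "abelian \<phi>"
      by (auto simp: family6_def abelian_multiplicative intro: abelian_sine_addition)
    moreover have "f x = 0 * chi x + - \<i> * \<phi> x" for x
      using 6 by (simp add: family6_def)
    moreover have "(\<forall>x. g x = 1 * chi x + 1 * \<phi> x) \<or> (\<forall>x. g x = 1 * chi x + (-1) * \<phi> x)"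
      using 6 by (auto simp: family6_def)
    ultimately show ?thesis using abelian_linear_combination by blast
  qed
qed

section \<open>Continuity\<close>

lemma cfun_linear_combination:
  assumes "u \<in> cfun T" "v \<in> cfun T" "\<And>x. h x = a * u x + b * v x"
  shows "h \<in> cfun T"
proof -
  have "h = (\<lambda>x. a * u x + b * v x)" using assms(3) by blast
  then show ?thesis
    using assms(1,2)
    by (simp add: cfun_def continuous_map_atin tendsto_add tendsto_mult_left)
qed

lemma cfun_right_translate:
  assumes "topological_semigroup T" "h \<in> cfun T"
  shows "(\<lambda>x. h (x * y)) \<in> cfun T"
proof -
  have "continuous_map T (prod_topology T T) (\<lambda>x. (x, y))"
    using assms(1) by (auto simp: topological_semigroup_def intro!: continuous_intros)
  then have "continuous_map T T ((\<lambda>(x, y). x * y) \<circ> (\<lambda>x. (x, y)))"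
    using assms(1) unfolding topological_semigroup_def by (blast intro: continuous_map_compose)
  then have "continuous_map T euclidean (h \<circ> ((\<lambda>(x, y). x * y) \<circ> (\<lambda>x. (x, y))))"
    using assms(2) unfolding cfun_def by (blast intro: continuous_map_compose)
  then show ?thesis by (simp add: cfun_def o_def)
qed

text \<open>
  With \<open>y\<close> fixed and \<open>f y \<noteq> 0\<close>, the equation writes \<open>f\<close> as a combination of \<open>g\<close> and a right
  translate of \<open>g\<close>, by the fixed element \<open>\<sigma> y\<close>.
\<close>

lemma solution_continuous:
  assumes top: "topological_semigroup T" and g: "g \<in> cfun T" and sol: "solution \<sigma> f g"
  shows "f \<in> cfun T"
proof (cases "\<exists>y. f y \<noteq> 0")
  case True
  then obtain y where y: "f y \<noteq> 0" by blast
  have "f x = (1 / f y) * g (x * \<sigma> y) + (- g y / f y) * g x" for x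
    using sol y by (simp add: solution_def field_simps)
  then show ?thesis
    using cfun_linear_combination[OF cfun_right_translate[OF top g] g] by blast
next
  case False
  then have "f = (\<lambda>x. 0)" by auto
  then show ?thesis by (simp add: cfun_def)
qed

lemma family3_continuous:
  assumes "f \<in> cfun T" "g \<in> cfun T" "family3 \<sigma> \<alpha> chi f g"
  shows "{f, chi, chi \<circ> \<sigma>} \<subseteq> cfun T"
proof -
  have "1 + \<alpha>\<^sup>2 \<noteq> 0"
    using assms(3) one_plus_square_nonzero by (simp add: family3_def)
  then have "chi x = (1 + \<alpha>\<^sup>2) * g x + 0 * g x" for x
    using assms(3) by (simp add: family3_def)
  then have "chi \<in> cfun T"
    using cfun_linear_combination[OF assms(2,2)] by blast
  then show ?thesis using assms by (simp add: family3_def)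
qed

lemma family4_continuous:
  assumes "f \<in> cfun T" "g \<in> cfun T" "family4 \<sigma> \<delta> chi1 chi2 f g"
  shows "{f, chi1, chi2} \<subseteq> cfun T"
proof -
  define s where "s = inverse \<delta> + \<delta>"
  have d: "\<delta> \<notin> {0, \<i>, - \<i>}" using assms(3) by (simp add: family4_def)
  then have s: "s \<noteq> 0" unfolding s_def by (rule inverse_plus_self_nonzero)
  have fs: "f x * s = chi2 x - chi1 x" and gs: "g x * s = inverse \<delta> * chi1 x + \<delta> * chi2 x" for x
    using assms(3) s by (auto simp: family4_def s_def)
  have "s * chi1 x = s * (1 * g x + (- \<delta>) * f x)" for x
  proof -
    have "s * (1 * g x + (- \<delta>) * f x) = g x * s - \<delta> * (f x * s)" by (simp add: algebra_simps)
    also have "\<dots> = s * chi1 x" unfolding fs gs by (simp add: s_def algebra_simps)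
    finally show ?thesis by (rule sym)
  qed
  then have "chi1 x = 1 * g x + (- \<delta>) * f x" for x
    by (rule iffD1[OF mult_left_cancel[OF s]])
  then have "chi1 \<in> cfun T"
    using cfun_linear_combination[OF assms(2,1)] by blast
  moreover have "chi2 x = 1 * chi1 x + s * f x" for x
    using fs[of x] by (simp add: algebra_simps)
  then have "chi2 \<in> cfun T"
    using cfun_linear_combination[OF \<open>chi1 \<in> cfun T\<close> assms(1)] by blast
  ultimately show ?thesis using assms(1) by simp
qed

lemma family5_continuous:
  assumes "f \<in> cfun T" "g \<in> cfun T" "family5 \<sigma> chi f g"
  shows "{f, chi, chi \<circ> \<sigma>} \<subseteq> cfun T"
proof -
  have "chi x = 1 * g x + \<i> * f x" "(chi \<circ> \<sigma>) x = 1 * g x + (- \<i>) * f x" for x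
    using assms(3) by (simp_all add: family5_def field_simps)
  then have "chi \<in> cfun T" "chi \<circ> \<sigma> \<in> cfun T"
    using cfun_linear_combination[OF assms(2,1)] by blast+
  then show ?thesis using assms(1) by simp
qed

lemma family6_continuous:
  assumes "f \<in> cfun T" "g \<in> cfun T" "family6 \<sigma> chi \<phi> f g"
  shows "{f, chi, chi \<circ> \<sigma>, \<phi>} \<subseteq> cfun T"
proof -
  have "\<phi> x = 0 * g x + \<i> * f x" for x
    using assms(3) by (simp add: family6_def)
  then have \<phi>: "\<phi> \<in> cfun T"
    using cfun_linear_combination[OF assms(2,1)] by blast
  have "(\<forall>x. chi x = 1 * g x + (-1) * \<phi> x) \<or> (\<forall>x. chi x = 1 * g x + 1 * \<phi> x)"
    using assms(3) by (auto simp: family6_def)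
  then have "chi \<in> cfun T"
    using cfun_linear_combination[OF assms(2) \<phi>] by blast
  then show ?thesis using assms \<phi> by (simp add: family6_def)
qed

section \<open>Classification with commutativity and continuity\<close>

theorem theorem3p3:
  fixes \<sigma> :: "'a::semigroup_mult \<Rightarrow> 'a" and f g :: "'a \<Rightarrow> complex"
  assumes "semigroup_automorphism \<sigma>"
  shows "(solution \<sigma> f g \<longleftrightarrow>
            family1 f g \<or>
            (\<exists>c. family2 c f g) \<or>
            (\<exists>\<alpha> chi. family3 \<sigma> \<alpha> chi f g) \<or>
            (\<exists>\<delta> chi1 chi2. family4 \<sigma> \<delta> chi1 chi2 f g) \<or>
            (\<exists>chi. family5 \<sigma> chi f g) \<or>
            (\<exists>chi \<phi>. family6 \<sigma> chi \<phi> f g)) \<and>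
         (solution \<sigma> f g \<longrightarrow> abelian f \<and> abelian g) \<and>
         (\<forall>T. topological_semigroup T \<and> g \<in> cfun T \<longrightarrow>
            (family1 f g \<longrightarrow> f \<in> cfun T) \<and>
            (\<forall>c. family2 c f g \<longrightarrow> f \<in> cfun T) \<and>
            (\<forall>\<alpha> chi. family3 \<sigma> \<alpha> chi f g \<longrightarrow> {f, chi, chi \<circ> \<sigma>} \<subseteq> cfun T) \<and>
            (\<forall>\<delta> chi1 chi2. family4 \<sigma> \<delta> chi1 chi2 f g \<longrightarrow> {f, chi1, chi2} \<subseteq> cfun T) \<and>
            (\<forall>chi. family5 \<sigma> chi f g \<longrightarrow> {f, chi, chi \<circ> \<sigma>} \<subseteq> cfun T) \<and>
            (\<forall>chi \<phi>. family6 \<sigma> chi \<phi> f g \<longrightarrow> {f, chi, chi \<circ> \<sigma>, \<phi>} \<subseteq> cfun T))"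
proof (intro conjI impI allI; (elim conjE)?)
  fix T
  assume T: "topological_semigroup T" "g \<in> cfun T"
  note f = solution_continuous[OF T]
  show "f \<in> cfun T" if "family1 f g"
    using f solution_family1[OF that] .
  show "f \<in> cfun T" if "family2 c f g" for c
    using f solution_family2[OF that] .
  show "{f, chi, chi \<circ> \<sigma>} \<subseteq> cfun T" if "family3 \<sigma> \<alpha> chi f g" for \<alpha> chi
    using family3_continuous[OF f[OF solution_family3[OF that]] T(2) that] .
  show "{f, chi1, chi2} \<subseteq> cfun T" if "family4 \<sigma> \<delta> chi1 chi2 f g" for \<delta> chi1 chi2
    using family4_continuous[OF f[OF solution_family4[OF that]] T(2) that] .
  show "{f, chi, chi \<circ> \<sigma>} \<subseteq> cfun T" if "family5 \<sigma> chi f g" for chi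
    using family5_continuous[OF f[OF solution_family5[OF assms that]] T(2) that] .
  show "{f, chi, chi \<circ> \<sigma>, \<phi>} \<subseteq> cfun T" if "family6 \<sigma> chi \<phi> f g" for chi \<phi>
    using family6_continuous[OF f[OF solution_family6[OF that]] T(2) that] .
qed (use solution_iff_families[OF assms] solution_abelian[OF assms] in blast)+

end
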